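(* Let $D$ be a digraph of order $n$ and let $k$ be an integer with $2\le k\le n$. The following assertions hold: (i) $0\leq \lambda_k(D)+\lambda_k(D^c)\leq n-1$. Moreover, both bounds are sharp. In particular, the lower bound is attained (i.e. $\lambda_k(D)+\lambda_k(D^c)=0$) if and only if $\lambda(D)=\lambda(D^c)=0$. (ii) $0\leq \lambda_k(D)\,\lambda_k(D^c)\leq \left\lfloor\left(\frac{n-1}{2}\right)^2\right\rfloor$. Moreover, both bounds are sharp. In particular, the lower bound is attained (i.e. $\lambda_k(D)\lambda_k(D^c)=0$) if and only if $\lambda(D)=0$ or $\lambda(D^c)=0$.
   Context: Digraphs are finite and have no parallel arcs or loops. The complement $D^c$ of a digraph $D$ is the digraph with $V(D^c)=V(D)$ such that, for distinct vertices $x,y$, $xy\in A(D^c)$ if and only if $xy\notin A(D)$. $\lambda(D)$ denotes the (classical) arc-strong connectivity of $D$. An out-tree is an oriented tree in which every vertex except one, called the root, has in-degree one. For $S\subseteq V(D)$ with $r\in S$ and $|S|\ge 2$, an $(S,r)$-tree is an out-tree $T$ in $D$ rooted at $r$ with $S\subseteq V(T)$. Two $(S,r)$-trees $T_1,T_2$ are arc-disjoint if $A(T_1)\cap A(T_2)=\emptyset$. $\lambda_{S,r}(D)$ is the maximum number of pairwise arc-disjoint $(S,r)$-trees in $D$. For $2\le k\le |V(D)|$, $\lambda_k(D)=\min\{\lambda_{S,r}(D)\mid S\subseteq V(D),\ |S|=k,\ r\in S\}$. A bound is sharp if there exist digraphs satisfying the hypotheses for which equality holds. *)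

theory Defs
  imports Complex_Main "Graph_Theory.Graph_Theory"
begin

(* Finite digraphs without loops or parallel arcs are the pair_digraph structures of
   Graph_Theory: arcs are ordered pairs of vertices. *)

definition digraph_complement :: "'a pair_pre_digraph \<Rightarrow> 'a pair_pre_digraph" where
  "digraph_complement D =
     \<lparr> pverts = pverts D,
       parcs = {(x, y). x \<in> pverts D \<and> y \<in> pverts D \<and> x \<noteq> y \<and> (x, y) \<notin> parcs D} \<rparr>"

definition delete_arcs :: "'a pair_pre_digraph \<Rightarrow> ('a \<times> 'a) set \<Rightarrow> 'a pair_pre_digraph" where
  "delete_arcs D W = \<lparr> pverts = pverts D, parcs = parcs D - W \<rparr>"

definition k_arc_strong :: "nat \<Rightarrow> 'a pair_pre_digraph \<Rightarrow> bool" where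
  "k_arc_strong m D \<longleftrightarrow>
     (\<forall>W. W \<subseteq> parcs D \<and> card W < m \<longrightarrow> strongly_connected (with_proj (delete_arcs D W)))"

(* Meaningful for finite digraphs with at least two vertices: deleting all arcs then
   destroys strong connectivity, so the greatest m exists.  It is 0 if D is not strong. *)
definition arc_strong_connectivity :: "'a pair_pre_digraph \<Rightarrow> nat" where
  "arc_strong_connectivity D = (GREATEST m. k_arc_strong m D)"

(* The library's tree predicate only forbids directed cycles, so it is not used here.
   In the symmetric closure every arc yields a closed walk of length two; the cycles of
   the underlying simple graph are the cycles of the closure of length at least three. *)
definition oriented_tree :: "'a pair_pre_digraph \<Rightarrow> bool" where
  "oriented_tree T \<longleftrightarrow>
     pair_digraph T \<and>
     (\<forall>u v. (u, v) \<in> parcs T \<longrightarrow> (v, u) \<notin> parcs T) \<and>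
     Digraph_Component.connected (with_proj T) \<and>
     \<not> (\<exists>p. pre_digraph.cycle (with_proj (mk_symmetric (with_proj T))) p \<and> 3 \<le> length p)"

definition out_tree :: "'a pair_pre_digraph \<Rightarrow> 'a \<Rightarrow> bool" where
  "out_tree T r \<longleftrightarrow>
     oriented_tree T \<and> r \<in> pverts T \<and>
     (\<forall>v \<in> pverts T. in_degree (with_proj T) v = 1 \<longleftrightarrow> v \<noteq> r)"

definition Sr_trees :: "'a pair_pre_digraph \<Rightarrow> 'a set \<Rightarrow> 'a \<Rightarrow> 'a pair_pre_digraph set" where
  "Sr_trees D S r =
     {T. out_tree T r \<and> subgraph (with_proj T) (with_proj D) \<and> S \<subseteq> pverts T}"

(* Families of pairwise arc-disjoint trees are sets of trees; no multiplicities are lost,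
   since for card S >= 2 every (S,r)-tree has an arc. *)
definition tree_connectivity_at :: "'a pair_pre_digraph \<Rightarrow> 'a set \<Rightarrow> 'a \<Rightarrow> nat" where
  "tree_connectivity_at D S r =
     Max {card F | F. F \<subseteq> Sr_trees D S r \<and> pairwise (\<lambda>T1 T2. parcs T1 \<inter> parcs T2 = {}) F}"

definition tree_connectivity :: "nat \<Rightarrow> 'a pair_pre_digraph \<Rightarrow> nat" where
  "tree_connectivity k D =
     Min {tree_connectivity_at D S r | S r. S \<subseteq> pverts D \<and> card S = k \<and> r \<in> S}"

end

theory Submission
  imports Defs
begin

text \<open>
  Write \<open>n\<close> for the order of \<open>D\<close>, \<open>D\<^sup>c\<close> for its complement and \<open>\<lambda>\<^sub>k\<close> for the tree connectivity.

  \<^bold>\<open>Upper bounds.\<close> If \<open>v \<in> S\<close> and \<open>v \<noteq> r\<close>, every \<open>(S,r)\<close>-tree has an arc into \<open>v\<close>, and arc-disjoint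
  trees have different ones; hence \<open>\<lambda>\<^sub>k(D)\<close> is at most the in-degree of \<open>v\<close>
  (\<open>tree_connectivity_at_le_in_neighbours\<close>).  The in-degrees of \<open>v\<close> in \<open>D\<close> and \<open>D\<^sup>c\<close> add up to
  \<open>n - 1\<close>, which bounds the sum, and the product by \<open>4ab \<le> (a + b)\<^sup>2\<close>.

  \<^bold>\<open>Vanishing.\<close> Both \<open>\<lambda>\<^sub>k(D)\<close> and \<open>\<lambda>(D)\<close> are positive exactly when \<open>D\<close> is strongly connected.
  A strong digraph has a breadth-first spanning out-tree from each root.  Conversely, choosing
  \<open>S\<close> to contain \<open>u\<close> and \<open>v\<close> yields an out-tree rooted at \<open>u\<close> that contains \<open>v\<close>, and in an
  out-tree every vertex is reachable from the root: going backwards along arcs can only stop at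
  the root, since there are no directed cycles (\<open>tree_connectivity_eq_0_iff\<close>).

  \<^bold>\<open>Sharpness.\<close> Lower bounds come from spanning out-trees described by parent functions: a map that
  sends each vertex other than the root to the tail of an arc into it and lowers some
  rank is an out-tree, and a family of such maps is arc-disjoint as soon as the
  parents of each single vertex are pairwise different
  (\<open>card_le_tree_connectivity_at_parents\<close>).  A transitive tournament and its complement are both
  not strong, giving the value \<open>0\<close>.  The complete digraph has \<open>n - 1\<close> arc-disjoint spanning
  out-trees from each root (the root, then a vertex \<open>j\<close>, then all others).  For the product take
  the circulant digraph on the integers modulo \<open>n\<close> with arcs from \<open>u\<close> to \<open>u + 1, \<dots>, u + m\<close>, where
  \<open>m = \<lfloor>(n - 1)/2\<rfloor>\<close>.  Its complement is the same kind of digraph with \<open>m\<close> replaced by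
  \<open>n - 1 - m\<close> and all arcs reversed.  Both parameters are so close to \<open>n/2\<close> that as many
  arc-disjoint spanning out-trees as the in-degree allows can be written down explicitly
  (\<open>circulant_parent\<close>).
\<close>

section \<open>Out-trees given by parent functions\<close>

definition parent_tree :: "'a set \<Rightarrow> 'a \<Rightarrow> ('a \<Rightarrow> 'a) \<Rightarrow> 'a pair_pre_digraph" where
  "parent_tree V r P = \<lparr> pverts = V, parcs = (\<lambda>v. (P v, v)) ` (V - {r}) \<rparr>"

lemma pcas_nth_step:
  "pcas u p v \<Longrightarrow> Suc i < length p \<Longrightarrow> fst (p ! Suc i) = snd (p ! i)"
proof (induction p arbitrary: u i)
  case (Cons e es)
  then show ?case by (cases i; cases es) auto
qed simp

lemma pcas_ends:
  "pcas u p v \<Longrightarrow> p \<noteq> [] \<Longrightarrow> fst (hd p) = u \<and> snd (last p) = v"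
  by (induction p arbitrary: u) auto

lemma pawalk_verts_tl: "tl (pawalk_verts u p) = map snd p" if "pcas u p v"
  using that
proof (induction p arbitrary: u)
  case (Cons e es)
  then show ?case by (cases es) auto
qed simp

text \<open>
  At a vertex of maximal rank on a cycle, both cyclic neighbours have at most that rank, so they
  coincide by uniqueness.  The vertices of a cycle being distinct, this is possible only if the
  cycle has fewer than three arcs.
\<close>

lemma no_long_cycle_if_unique_lower_neighbour:
  fixes h :: "'a \<Rightarrow> nat"
  assumes lower: "\<And>a b. (a, b) \<in> parcs G \<Longrightarrow> (b, a) \<in> parcs G"
    and unique: "\<And>a b w. (a, w) \<in> parcs G \<Longrightarrow> (b, w) \<in> parcs G \<Longrightarrow> h a \<le> h w \<Longrightarrow> h b \<le> h w \<Longrightarrow> a = b"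
    and cyc: "pre_digraph.cycle (with_proj G) p"
  shows "length p < 3"
proof (rule ccontr)
  assume "\<not> length p < 3"
  then have len: "3 \<le> length p" by simp
  let ?n = "length p"
  from cyc obtain u where p: "set p \<subseteq> parcs G" "pcas u p u" "distinct (map snd p)"
    unfolding pre_digraph.cycle_def pre_digraph.awalk_def
    by (auto simp: cas_with_proj_eq awalk_verts_with_proj_eq pawalk_verts_tl)
  have next_arc: "fst (p ! (Suc i mod ?n)) = snd (p ! i)" if "i < ?n" for i
  proof (cases "Suc i < ?n")
    case True
    then show ?thesis using pcas_nth_step[OF p(2)] by simp
  next
    case False
    then have i: "Suc i = ?n" "i = ?n - 1" using that by auto
    have "p \<noteq> []" using len by auto
    with pcas_ends[OF p(2)] show ?thesis
      using i by (simp add: hd_conv_nth last_conv_nth)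
  qed
  define M where "M = Max ((\<lambda>i. h (snd (p ! i))) ` {..<?n})"
  have "0 \<in> {..<?n}" using len by auto
  then have ne: "{..<?n} \<noteq> {}" by blast
  have le: "h (snd (p ! i)) \<le> M" if "i < ?n" for i
    unfolding M_def using that by (intro Max_ge) auto
  have "M \<in> (\<lambda>i. h (snd (p ! i))) ` {..<?n}"
    unfolding M_def using ne by (intro Max_in) auto
  then obtain i where i: "i < ?n" "h (snd (p ! i)) = M" by auto
  let ?w = "snd (p ! i)"
  \<comment> \<open>the arc numbered i ends in a vertex of maximal rank; j and l number the arcs after and before it on the cycle\<close>
  define j where "j = Suc i mod ?n"
  define l where "l = (i + ?n - 1) mod ?n"
  have jl: "j < ?n" "l < ?n" unfolding j_def l_def using len by (auto intro!: mod_less_divisor)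
  have "j \<noteq> l"
  proof (cases "i = 0")
    case True
    then show ?thesis using len by (auto simp: j_def l_def)
  next
    case False
    then have "l = i - 1"
      using i(1) by (simp add: l_def mod_if)
    then show ?thesis using False len i(1) by (auto simp: j_def mod_if)
  qed
  have "Suc l mod ?n = i"
  proof (cases "i = 0")
    case False
    then have "l = i - 1" using i(1) by (simp add: l_def mod_if)
    then show ?thesis using False i(1) by simp
  next
    case True
    moreover have "Suc (?n - Suc 0) = ?n" using len by linarith
    ultimately show ?thesis by (simp add: l_def)
  qed
  with next_arc[OF jl(2)] have a: "fst (p ! i) = snd (p ! l)" by simp
  from next_arc[OF i(1)] have b: "fst (p ! j) = ?w" by (simp add: j_def)
  have "(snd (p ! l), ?w) \<in> parcs G"
    using p(1) i(1) a by (metis nth_mem prod.collapse subsetD)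
  moreover have "(snd (p ! j), ?w) \<in> parcs G"
    using p(1) jl(1) b by (metis lower nth_mem prod.collapse subsetD)
  ultimately have "snd (p ! l) = snd (p ! j)"
    using unique le jl i(2) by metis
  with p(3) jl \<open>j \<noteq> l\<close> show False
    by (auto simp: distinct_conv_nth)
qed

text \<open>
  The rank \<open>h\<close> makes following parents terminate, necessarily at \<open>r\<close>, which gives connectedness.  It
  also rules out undirected cycles: among the neighbours of a vertex only its parent does not
  have larger rank.
\<close>

lemma out_tree_parent_tree:
  fixes h :: "'a \<Rightarrow> nat"
  assumes fin: "finite V" and r: "r \<in> V"
    and P: "\<And>v. v \<in> V - {r} \<Longrightarrow> P v \<in> V \<and> h (P v) < h v"
  shows "out_tree (parent_tree V r P) r"
proof -
  let ?T = "parent_tree V r P"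
  have arcs: "(a, b) \<in> parcs ?T \<longleftrightarrow> b \<in> V \<and> b \<noteq> r \<and> a = P b" for a b
    by (auto simp: parent_tree_def)
  have verts: "pverts ?T = V" by (simp add: parent_tree_def)
  have P': "P v \<in> V" "P v \<noteq> v" if "v \<in> V" "v \<noteq> r" for v
    using P[of v] that by auto
  have arc_props: "fst e \<in> V" "snd e \<in> V" "fst e \<noteq> snd e" if "e \<in> parcs ?T" for e
  proof -
    from that obtain v where "e = (P v, v)" "v \<in> V" "v \<noteq> r"
      by (auto simp: parent_tree_def)
    then show "fst e \<in> V" "snd e \<in> V" "fst e \<noteq> snd e" using P' by auto
  qed
  have pd: "pair_digraph ?T"
  proof
    show "finite (parcs ?T)" "finite (pverts ?T)" using fin by (auto simp: parent_tree_def)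
  qed (use arc_props in \<open>auto simp: verts\<close>)
  interpret T: pair_digraph ?T by fact
  let ?M = "mk_symmetric (with_proj ?T)"
  have sym_arcs: "(a, b) \<in> parcs ?M \<longleftrightarrow> (a, b) \<in> parcs ?T \<or> (b, a) \<in> parcs ?T" for a b
    unfolding parcs_mk_symmetric by auto (auto intro: bexI[of _ "(b, a)"])
  have reach: "reachable (with_proj ?T) r v" if "v \<in> V" for v
    using that
  proof (induction "h v" arbitrary: v rule: less_induct)
    case less
    show ?case
    proof (cases "v = r")
      case True
      then show ?thesis using r verts by auto
    next
      case False
      then have "reachable (with_proj ?T) r (P v)" "(P v, v) \<in> parcs ?T"
        using less P[of v] by (auto simp: arcs)
      then show ?thesis using T.reachable_adj_trans by blast
    qed
  qed
  have conn: "Digraph_Component.connected (with_proj ?T)"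
    unfolding connected_def strongly_connected_def
  proof (intro conjI ballI)
    interpret M: pair_wf_digraph ?M by (rule T.wellformed_mk_symmetric)
    fix u v assume "u \<in> verts (with_proj ?M)" "v \<in> verts (with_proj ?M)"
    then have "u \<in> V" "v \<in> V" by (auto simp: verts)
    then have "reachable (with_proj ?M) r u" "reachable (with_proj ?M) r v"
      using reach T.reachable_mk_symmetricI by blast+
    then show "reachable (with_proj ?M) u v"
      using symmetric_reachable[OF symmetric_mk_symmetric] M.reachable_trans by metis
  qed (use r verts in auto)
  have "length p < 3" if "pre_digraph.cycle (with_proj ?M) p" for p
  proof (rule no_long_cycle_if_unique_lower_neighbour[OF _ _ that])
    show "a = b" if "(a, w) \<in> parcs ?M" "(b, w) \<in> parcs ?M" "h a \<le> h w" "h b \<le> h w" for a b w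
      using that P unfolding sym_arcs arcs by (metis DiffI empty_iff insert_iff not_le)
  qed (auto simp: sym_arcs)
  moreover have "(v, u) \<notin> parcs ?T" if "(u, v) \<in> parcs ?T" for u v
    using that P unfolding arcs by (metis DiffI empty_iff insert_iff less_asym)
  ultimately have "oriented_tree ?T"
    using pd conn by (force simp: oriented_tree_def)
  moreover have "in_degree (with_proj ?T) v = (if v = r then 0 else 1)" if "v \<in> V" for v
  proof -
    have "in_arcs (with_proj ?T) v = (if v = r then {} else {(P v, v)})"
      using that by (auto simp: in_arcs_def arcs)
    then show ?thesis by (simp add: in_degree_def)
  qed
  ultimately show ?thesis
    using r by (auto simp: out_tree_def verts)
qed

section \<open>The structure of out-trees\<close>

text \<open>
  A directed cycle of length at least three would be a cycle of the underlying graph; length one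
  is a loop, and length two is a pair of opposite arcs.
\<close>

lemma acyclic_oriented_tree:
  assumes "oriented_tree T"
  shows "acyclic (parcs T)"
proof (rule acyclicI, intro allI notI)
  fix x assume x: "(x, x) \<in> (parcs T)\<^sup>+"
  interpret T: pair_digraph T using assms by (simp add: oriented_tree_def)
  let ?M = "mk_symmetric (with_proj T)"
  interpret M: pair_wf_digraph ?M by (rule T.wellformed_mk_symmetric)
  from x obtain p where "T.awalk x p x" "p \<noteq> []"
    using T.reachable1_awalk by auto
  then have "T.closed_w p" by (auto simp: T.closed_w_def)
  then obtain c where c: "T.cycle c" using T.closed_w_imp_cycle by blast
  then obtain u where u: "T.awalk u c u" "distinct (tl (pawalk_verts u c))" "c \<noteq> []"
    unfolding T.cycle_def by auto
  have "subgraph (with_proj T) (with_proj ?M)"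
    unfolding subgraph_def compatible_def
    using T.wf_digraph M.wf_digraph by (auto simp: parcs_mk_symmetric)
  then have "pre_digraph.cycle (with_proj ?M) c"
    using c M.subgraph_cycle by blast
  then have "length c < 3"
    using assms by (auto simp: oriented_tree_def)
  then consider e where "c = [e]" | e f where "c = [e, f]"
    using u(3) by (cases c; cases "tl c"; cases "tl (tl c)") auto
  then show False
  proof cases
    case 1
    then show ?thesis using u(1) T.no_loops[of e] by (auto simp: T.awalk_def)
  next
    case 2
    then have "(fst e, snd e) \<in> parcs T" "(snd e, fst e) \<in> parcs T"
      using u(1) by (auto simp: T.awalk_def) (metis prod.collapse)
    then show ?thesis using assms by (auto simp: oriented_tree_def)
  qed
qed

lemma out_tree_in_arc:
  assumes "out_tree T r" "v \<in> pverts T" "v \<noteq> r"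
  obtains u where "(u, v) \<in> parcs T"
proof -
  have "in_degree (with_proj T) v = 1" using assms by (auto simp: out_tree_def)
  then have "in_arcs (with_proj T) v \<noteq> {}" by (auto simp: in_degree_def)
  then show ?thesis using that by (auto simp: in_arcs_def)
qed

text \<open>
  A finite acyclic arc relation is well-founded, so one may induct along the in-arc that every
  vertex other than \<open>r\<close> has.
\<close>

lemma out_tree_reachable:
  assumes T: "out_tree T r" and v: "v \<in> pverts T"
  shows "(r, v) \<in> (parcs T)\<^sup>*"
proof -
  have ot: "oriented_tree T" using T by (simp add: out_tree_def)
  interpret T: pair_digraph T using ot by (simp add: oriented_tree_def)
  have "wf (parcs T)"
    by (rule finite_acyclic_wf[OF T.pair_finite_arcs acyclic_oriented_tree[OF ot]])
  then show ?thesis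
    using v
  proof (induction v rule: wf_induct_rule)
    case (less v)
    show ?case
    proof (cases "v = r")
      case False
      with T less.prems obtain u where "(u, v) \<in> parcs T" by (rule out_tree_in_arc)
      then show ?thesis using less.IH T.in_arcsD1 by (meson rtrancl.rtrancl_into_rtrancl)
    qed simp
  qed
qed

section \<open>Bounds for the tree connectivity\<close>

lemma obtain_other_element:
  assumes "2 \<le> card S"
  obtains v where "v \<in> S" "v \<noteq> r"
proof -
  have "\<not> S \<subseteq> {r}"
    using assms card_mono[of "{r}" S] by auto
  then show ?thesis using that by auto
qed

lemma finite_Sr_trees:
  assumes "pair_digraph D"
  shows "finite (Sr_trees D S r)"
proof -
  interpret D: pair_digraph D by fact
  have "Sr_trees D S r \<subseteq> (\<lambda>(A, B). \<lparr>pverts = A, parcs = B\<rparr>) ` (Pow (pverts D) \<times> Pow (parcs D))"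
  proof
    fix T assume "T \<in> Sr_trees D S r"
    then have "pverts T \<subseteq> pverts D" "parcs T \<subseteq> parcs D"
      by (auto simp: Sr_trees_def subgraph_def)
    then show "T \<in> (\<lambda>(A, B). \<lparr>pverts = A, parcs = B\<rparr>) ` (Pow (pverts D) \<times> Pow (parcs D))"
      by (intro image_eqI[of T _ "(pverts T, parcs T)"]) auto
  qed
  then show ?thesis
    by (rule finite_subset) (use D.pair_finite_verts D.pair_finite_arcs in auto)
qed

lemma tree_packing_sizes:
  assumes "pair_digraph D"
  shows "finite {card F | F. F \<subseteq> Sr_trees D S r \<and> pairwise (\<lambda>T1 T2. parcs T1 \<inter> parcs T2 = {}) F}"
    and "{card F | F. F \<subseteq> Sr_trees D S r \<and> pairwise (\<lambda>T1 T2. parcs T1 \<inter> parcs T2 = {}) F} \<noteq> {}"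
proof -
  have "{card F | F. F \<subseteq> Sr_trees D S r \<and> pairwise (\<lambda>T1 T2. parcs T1 \<inter> parcs T2 = {}) F}
      \<subseteq> card ` Pow (Sr_trees D S r)" by auto
  then show "finite {card F | F. F \<subseteq> Sr_trees D S r \<and> pairwise (\<lambda>T1 T2. parcs T1 \<inter> parcs T2 = {}) F}"
    by (rule finite_subset) (use finite_Sr_trees[OF assms] in auto)
  show "{card F | F. F \<subseteq> Sr_trees D S r \<and> pairwise (\<lambda>T1 T2. parcs T1 \<inter> parcs T2 = {}) F} \<noteq> {}"
    using pairwise_empty by blast
qed

lemma card_le_tree_connectivity_at:
  assumes "pair_digraph D" "F \<subseteq> Sr_trees D S r"
    "pairwise (\<lambda>T1 T2. parcs T1 \<inter> parcs T2 = {}) F"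
  shows "card F \<le> tree_connectivity_at D S r"
  unfolding tree_connectivity_at_def
  using assms tree_packing_sizes(1)[OF assms(1)] by (intro Max_ge) auto

lemma obtain_optimal_packing:
  assumes "pair_digraph D"
  obtains F where "F \<subseteq> Sr_trees D S r" "pairwise (\<lambda>T1 T2. parcs T1 \<inter> parcs T2 = {}) F"
    "card F = tree_connectivity_at D S r"
proof -
  have "tree_connectivity_at D S r \<in>
      {card F | F. F \<subseteq> Sr_trees D S r \<and> pairwise (\<lambda>T1 T2. parcs T1 \<inter> parcs T2 = {}) F}"
    unfolding tree_connectivity_at_def by (rule Max_in[OF tree_packing_sizes[OF assms]])
  then show ?thesis using that by auto
qed

text \<open>
  Every tree of a packing uses an arc into \<open>v\<close>, and these arcs are different for different trees.
\<close>

lemma tree_connectivity_at_le_in_neighbours: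
  assumes D: "pair_digraph D" and v: "v \<in> S" "v \<noteq> r"
  shows "tree_connectivity_at D S r \<le> card {u. (u, v) \<in> parcs D}"
proof -
  interpret D: pair_digraph D by fact
  obtain F where F: "F \<subseteq> Sr_trees D S r" "pairwise (\<lambda>T1 T2. parcs T1 \<inter> parcs T2 = {}) F"
    "card F = tree_connectivity_at D S r"
    using obtain_optimal_packing[OF D] .
  have "\<forall>T\<in>F. \<exists>u. (u, v) \<in> parcs T"
    using F(1) v by (auto simp: Sr_trees_def elim!: out_tree_in_arc)
  then obtain f where f: "\<And>T. T \<in> F \<Longrightarrow> (f T, v) \<in> parcs T" by metis
  have "inj_on f F"
    using F(2) f by (fastforce simp: inj_on_def pairwise_def)
  moreover have "f ` F \<subseteq> {u. (u, v) \<in> parcs D}"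
    using F(1) f by (fastforce simp: Sr_trees_def subgraph_def)
  moreover have "finite {u. (u, v) \<in> parcs D}"
    by (rule finite_subset[OF _ D.pair_finite_verts]) (auto dest: D.in_arcsD1)
  ultimately show ?thesis
    using F(3) by (metis card_image card_mono)
qed

text \<open>
  The source of all lower bounds.  The trees here are spanning, hence serve for every \<open>S\<close> that
  contains the root.  Two trees can share an arc only at its head \<open>v\<close>, where injectivity of the
  choice of parents excludes it; since \<open>S\<close> has a second vertex, each tree has an arc, so that
  disjoint trees are also different.
\<close>

lemma card_le_tree_connectivity_at_parents:
  fixes h :: "'i \<Rightarrow> 'a \<Rightarrow> nat"
  assumes D: "pair_digraph D" and S: "S \<subseteq> pverts D" "r \<in> S" "2 \<le> card S"
    and P: "\<And>j v. j \<in> J \<Longrightarrow> v \<in> pverts D - {r} \<Longrightarrow> (P j v, v) \<in> parcs D \<and> h j (P j v) < h j v"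
    and inj: "\<And>v. v \<in> pverts D - {r} \<Longrightarrow> inj_on (\<lambda>j. P j v) J"
  shows "card J \<le> tree_connectivity_at D S r"
proof -
  interpret D: pair_digraph D by fact
  let ?T = "\<lambda>j. parent_tree (pverts D) r (P j)"
  have r: "r \<in> pverts D" using S by auto
  have tree: "out_tree (?T j) r" if "j \<in> J" for j
    using P[OF that] D.in_arcsD1
    by (intro out_tree_parent_tree[where h = "h j"] D.pair_finite_verts r) blast+
  have "?T j \<in> Sr_trees D S r" if "j \<in> J" for j
  proof -
    have "pair_digraph (?T j)"
      using tree[OF that] by (simp add: out_tree_def oriented_tree_def)
    then have "wf_digraph (with_proj (?T j))"
      by (simp add: wf_digraph_wp_iff pair_digraph.pair_wf_digraph)
    then have "subgraph (with_proj (?T j)) (with_proj D)"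
      using P[OF that] D.wf_digraph
      by (auto simp: subgraph_def compatible_def parent_tree_def)
    then show ?thesis
      using tree[OF that] S by (simp add: Sr_trees_def) (simp add: parent_tree_def)
  qed
  moreover have disj: "parcs (?T i) \<inter> parcs (?T j) = {}" if "i \<in> J" "j \<in> J" "i \<noteq> j" for i j
    using that inj by (auto simp: parent_tree_def inj_on_def)
  moreover obtain v where v: "v \<in> S" "v \<noteq> r"
    using S(3) obtain_other_element by metis
  have "inj_on ?T J"
  proof (rule inj_onI, rule ccontr)
    fix i j assume ij: "i \<in> J" "j \<in> J" "?T i = ?T j" "i \<noteq> j"
    then have "parcs (?T i) = {}" using disj[of i j] by simp
    then show False using v S(1) by (auto simp: parent_tree_def)
  qed
  ultimately have "card (?T ` J) \<le> tree_connectivity_at D S r"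
    by (intro card_le_tree_connectivity_at D) (auto simp: pairwise_def)
  then show ?thesis using \<open>inj_on ?T J\<close> by (simp add: card_image)
qed

lemma tree_connectivity_values:
  assumes "pair_digraph D" "k \<le> card (pverts D)" "1 \<le> k"
  shows "finite {tree_connectivity_at D S r | S r. S \<subseteq> pverts D \<and> card S = k \<and> r \<in> S}"
    and "{tree_connectivity_at D S r | S r. S \<subseteq> pverts D \<and> card S = k \<and> r \<in> S} \<noteq> {}"
proof -
  interpret D: pair_digraph D by fact
  have "{tree_connectivity_at D S r | S r. S \<subseteq> pverts D \<and> card S = k \<and> r \<in> S}
    \<subseteq> (\<lambda>(S, r). tree_connectivity_at D S r) ` (Pow (pverts D) \<times> pverts D)" by auto
  then show "finite {tree_connectivity_at D S r | S r. S \<subseteq> pverts D \<and> card S = k \<and> r \<in> S}"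
    by (rule finite_subset) (use D.pair_finite_verts in auto)
  obtain S where S: "S \<subseteq> pverts D" "card S = k"
    using assms(2) by (meson obtain_subset_with_card_n)
  then have "S \<noteq> {}" using assms(3) by auto
  then show "{tree_connectivity_at D S r | S r. S \<subseteq> pverts D \<and> card S = k \<and> r \<in> S} \<noteq> {}"
    using S by blast
qed

lemma tree_connectivity_le:
  assumes "pair_digraph D" "S \<subseteq> pverts D" "card S = k" "r \<in> S" "1 \<le> k"
  shows "tree_connectivity k D \<le> tree_connectivity_at D S r"
proof -
  have "k \<le> card (pverts D)"
    using assms pair_fin_digraph.pair_finite_verts[of D] card_mono
    by (metis pair_digraph_def)
  then show ?thesis
    unfolding tree_connectivity_def
    using assms tree_connectivity_values(1)[of D k] by (intro Min_le) auto
qed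

lemma le_tree_connectivityI:
  assumes "pair_digraph D" "k \<le> card (pverts D)" "1 \<le> k"
    and "\<And>S r. S \<subseteq> pverts D \<Longrightarrow> card S = k \<Longrightarrow> r \<in> S \<Longrightarrow> m \<le> tree_connectivity_at D S r"
  shows "m \<le> tree_connectivity k D"
  unfolding tree_connectivity_def
  using assms tree_connectivity_values[OF assms(1-3)] by (subst Min_ge_iff) auto

lemma pair_digraph_complement:
  assumes "pair_digraph D"
  shows "pair_digraph (digraph_complement D)"
proof -
  interpret D: pair_digraph D by fact
  show ?thesis
  proof
    show "finite (parcs (digraph_complement D))"
      by (rule finite_subset[of _ "pverts D \<times> pverts D"])
        (auto simp: digraph_complement_def D.pair_finite_verts)
  qed (auto simp: digraph_complement_def D.pair_finite_verts)
qed

lemma pverts_complement [simp]: "pverts (digraph_complement D) = pverts D"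
  by (simp add: digraph_complement_def)

text \<open>
  The in-neighbours of any vertex \<open>v\<close> in a digraph and in its complement partition the other
  vertices.
\<close>

lemma tree_connectivity_complement_sum_le:
  assumes D: "pair_digraph D" and k: "2 \<le> k" "k \<le> card (pverts D)"
  shows "tree_connectivity k D + tree_connectivity k (digraph_complement D) \<le> card (pverts D) - 1"
proof -
  interpret D: pair_digraph D by fact
  let ?C = "digraph_complement D"
  have C: "pair_digraph ?C" using pair_digraph_complement[OF D] .
  obtain S where S: "S \<subseteq> pverts D" "card S = k"
    using k(2) by (meson obtain_subset_with_card_n)
  then have "S \<noteq> {}" using k(1) by auto
  then obtain r where "r \<in> S" by blast
  moreover obtain v where "v \<in> S" "v \<noteq> r"
    using obtain_other_element[of S r] k(1) S(2) by blast
  ultimately have rv: "r \<in> S" "v \<in> S" "v \<noteq> r" by auto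
  let ?A = "{u. (u, v) \<in> parcs D}" and ?B = "{u. (u, v) \<in> parcs ?C}"
  have AB: "?A \<inter> ?B = {}" "?A \<union> ?B = pverts D - {v}"
    using rv S(1) D.in_arcsD1 D.no_loops'[of v v] by (auto simp: digraph_complement_def)
  have v: "v \<in> pverts D" using rv S(1) by auto
  have "finite (?A \<union> ?B)" using AB(2) D.pair_finite_verts by simp
  then have "card ?A + card ?B = card (?A \<union> ?B)"
    using AB(1) by (simp add: card_Un_disjoint)
  then have "card ?A + card ?B = card (pverts D) - 1"
    using AB(2) v by simp
  moreover have "tree_connectivity k D \<le> card ?A"
    using tree_connectivity_le[OF D S rv(1)] tree_connectivity_at_le_in_neighbours[OF D rv(2,3)] k
    by linarith
  moreover have "tree_connectivity k ?C \<le> card ?B"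
    using tree_connectivity_le[OF C _ S(2) rv(1)] S(1)
      tree_connectivity_at_le_in_neighbours[OF C rv(2,3)] k
    by force
  ultimately show ?thesis by linarith
qed

lemma mult_le_floor_half_square:
  assumes "a + b \<le> n - 1" "1 \<le> n"
  shows "int (a * b) \<le> \<lfloor>((real n - 1) / 2) ^ 2\<rfloor>"
proof -
  have "real a + real b \<le> real n - 1" using assms by linarith
  then have "(real a + real b)\<^sup>2 \<le> (real n - 1)\<^sup>2" by (intro power_mono) auto
  moreover have "4 * (real a * real b) \<le> (real a + real b)\<^sup>2"
    using zero_le_power2[of "real a - real b"] by (simp add: power2_eq_square algebra_simps)
  ultimately have "real a * real b \<le> ((real n - 1) / 2) ^ 2"
    by (simp add: power_divide)
  then show ?thesis by (simp add: le_floor_iff)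
qed

section \<open>Vanishing of the connectivities\<close>

text \<open>
  Deleting all arcs disconnects two different vertices, so the numbers \<open>m\<close> with \<open>k_arc_strong m D\<close>
  are bounded and the greatest one exists; being \<open>1\<close>-arc-strong is the same as being strong.
\<close>

lemma arc_strong_connectivity_eq_0_iff:
  assumes D: "pair_digraph D" and n: "2 \<le> card (pverts D)"
  shows "arc_strong_connectivity D = 0 \<longleftrightarrow> \<not> strongly_connected (with_proj D)"
proof -
  interpret D: pair_digraph D by fact
  have bound: "m \<le> card (parcs D)" if m: "k_arc_strong m D" for m
  proof (rule ccontr)
    assume "\<not> m \<le> card (parcs D)"
    then have sc: "strongly_connected (with_proj (delete_arcs D (parcs D)))"
      using m unfolding k_arc_strong_def by (metis not_le subset_refl)
    from n have "pverts D \<noteq> {}" by auto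
    then obtain u where u: "u \<in> pverts D" by blast
    moreover obtain v where "v \<in> pverts D" "v \<noteq> u"
      using obtain_other_element[OF n] by blast
    ultimately have uv: "u \<in> pverts D" "v \<in> pverts D" "u \<noteq> v" by auto
    then have "reachable (with_proj (delete_arcs D (parcs D))) u v"
      using sc unfolding strongly_connected_def by (simp add: delete_arcs_def)
    then have "(u, v) \<in> rtrancl_on (pverts D) {}"
      by (simp add: reachable_def delete_arcs_def)
    then have "(u, v) \<in> {}\<^sup>*" by (rule rtrancl_on_rtranclI)
    then have "u = v" by simp
    with uv show False by simp
  qed
  have one: "k_arc_strong 1 D \<longleftrightarrow> strongly_connected (with_proj D)"
  proof -
    have "delete_arcs D {} = D" by (simp add: delete_arcs_def)
    moreover have "W \<subseteq> parcs D \<and> card W < 1 \<longleftrightarrow> W = {}" for W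
      using finite_subset[OF _ D.pair_finite_arcs, of W] by auto
    ultimately show ?thesis by (simp add: k_arc_strong_def)
  qed
  have zero: "k_arc_strong 0 D" by (simp add: k_arc_strong_def)
  show ?thesis
  proof
    assume "arc_strong_connectivity D = 0"
    moreover have "1 \<le> arc_strong_connectivity D" if "k_arc_strong 1 D"
      unfolding arc_strong_connectivity_def using that bound by (rule Greatest_le_nat)
    ultimately show "\<not> strongly_connected (with_proj D)" using one by auto
  next
    assume ns: "\<not> strongly_connected (with_proj D)"
    have "k_arc_strong (arc_strong_connectivity D) D"
      unfolding arc_strong_connectivity_def using zero bound by (rule GreatestI_nat)
    then have "k_arc_strong 1 D" if "arc_strong_connectivity D \<noteq> 0"
      using that unfolding k_arc_strong_def by (metis One_nat_def Suc_leI less_le_trans neq0_conv)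
    then show "arc_strong_connectivity D = 0" using ns one by blast
  qed
qed

text \<open>
  Breadth-first search: the parent of \<open>v\<close> is the predecessor of \<open>v\<close> on a shortest walk from the root,
  and the rank is the distance from the root.
\<close>

lemma strongly_connected_imp_tree_connectivity_pos:
  assumes D: "pair_digraph D" and k: "2 \<le> k" "k \<le> card (pverts D)"
    and sc: "strongly_connected (with_proj D)"
  shows "1 \<le> tree_connectivity k D"
proof (rule le_tree_connectivityI[OF D k(2)])
  fix S r assume S: "S \<subseteq> pverts D" "card S = k" "r \<in> S"
  interpret D: pair_digraph D by fact
  define h where "h v = (LEAST i. (r, v) \<in> parcs D ^^ i)" for v
  have "\<exists>u. (u, v) \<in> parcs D \<and> h u < h v" if v: "v \<in> pverts D - {r}" for v
  proof -
    have "reachable (with_proj D) r v"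
      using sc v S by (auto simp: strongly_connected_def)
    then have "(r, v) \<in> (parcs D)\<^sup>*" by (auto simp: D.reachable_conv)
    then have hv: "(r, v) \<in> parcs D ^^ h v"
      unfolding h_def by (metis LeastI_ex rtrancl_imp_relpow)
    with v obtain i where i: "h v = Suc i" by (cases "h v") auto
    with hv obtain u where u: "(r, u) \<in> parcs D ^^ i" "(u, v) \<in> parcs D" by auto
    have "h u \<le> i" unfolding h_def using u(1) by (rule Least_le)
    then show ?thesis using u(2) i by auto
  qed
  then obtain P where "\<And>v. v \<in> pverts D - {r} \<Longrightarrow> (P v, v) \<in> parcs D \<and> h (P v) < h v"
    by metis
  then have "card {()} \<le> tree_connectivity_at D S r"
    using S k by (intro card_le_tree_connectivity_at_parents[OF D, where P = "\<lambda>_. P" and h = "\<lambda>_. h"]) auto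
  then show "1 \<le> tree_connectivity_at D S r" by simp
qed (use k in simp)

text \<open>
  To connect \<open>u\<close> to \<open>v\<close>, take any \<open>S\<close> of size \<open>k\<close> containing both and a tree rooted at \<open>u\<close>.
\<close>

lemma tree_connectivity_pos_imp_strongly_connected:
  assumes D: "pair_digraph D" and k: "2 \<le> k" "k \<le> card (pverts D)"
    and pos: "1 \<le> tree_connectivity k D"
  shows "strongly_connected (with_proj D)"
  unfolding strongly_connected_def
proof (intro conjI ballI)
  interpret D: pair_digraph D by fact
  show "verts (with_proj D) \<noteq> {}" using k by auto
  fix u v assume "u \<in> verts (with_proj D)" "v \<in> verts (with_proj D)"
  then have uv: "{u, v} \<subseteq> pverts D" by auto
  have "card {u, v} \<le> k" using k(1) by (simp add: card_insert_if)
  then obtain S where S: "{u, v} \<subseteq> S" "S \<subseteq> pverts D" "card S = k"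
    using exists_subset_between[OF _ k(2) uv D.pair_finite_verts] by metis
  obtain F where F: "F \<subseteq> Sr_trees D S u" "card F = tree_connectivity_at D S u"
    using obtain_optimal_packing[OF D] by metis
  have "1 \<le> card F"
    using pos tree_connectivity_le[OF D S(2,3), of u] S(1) k F(2) by simp
  then obtain T where "T \<in> F" by fastforce
  then have "T \<in> Sr_trees D S u" using F(1) by auto
  then have T: "out_tree T u" "v \<in> pverts T" "parcs T \<subseteq> parcs D"
    using S(1) by (auto simp: Sr_trees_def subgraph_def)
  have "(u, v) \<in> (parcs D)\<^sup>*"
    using out_tree_reachable[OF T(1,2)] rtrancl_mono[OF T(3)] by blast
  then show "reachable (with_proj D) u v" using uv by (auto simp: D.reachable_conv)
qed

lemma tree_connectivity_eq_0_iff: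
  assumes "pair_digraph D" "2 \<le> k" "k \<le> card (pverts D)"
  shows "tree_connectivity k D = 0 \<longleftrightarrow> arc_strong_connectivity D = 0"
proof -
  have "arc_strong_connectivity D = 0 \<longleftrightarrow> \<not> strongly_connected (with_proj D)"
    using assms by (intro arc_strong_connectivity_eq_0_iff) auto
  moreover have "strongly_connected (with_proj D) \<longleftrightarrow> 1 \<le> tree_connectivity k D"
    using strongly_connected_imp_tree_connectivity_pos[OF assms]
      tree_connectivity_pos_imp_strongly_connected[OF assms] by blast
  ultimately show ?thesis by auto
qed

lemma tree_connectivity_complement_bounds:
  assumes "pair_digraph D" "card (pverts D) = n" "2 \<le> k" "k \<le> n"
  shows "tree_connectivity k D + tree_connectivity k (digraph_complement D) \<le> n - 1"
    and "int (tree_connectivity k D * tree_connectivity k (digraph_complement D))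
      \<le> \<lfloor>((real n - 1) / 2) ^ 2\<rfloor>"
    and "tree_connectivity k D = 0 \<longleftrightarrow> arc_strong_connectivity D = 0"
    and "tree_connectivity k (digraph_complement D) = 0 \<longleftrightarrow> arc_strong_connectivity (digraph_complement D) = 0"
proof -
  show sum: "tree_connectivity k D + tree_connectivity k (digraph_complement D) \<le> n - 1"
    using tree_connectivity_complement_sum_le[of D k] assms by simp
  show "int (tree_connectivity k D * tree_connectivity k (digraph_complement D))
      \<le> \<lfloor>((real n - 1) / 2) ^ 2\<rfloor>"
    using assms by (intro mult_le_floor_half_square[OF sum]) simp
  show "tree_connectivity k D = 0 \<longleftrightarrow> arc_strong_connectivity D = 0"
    using assms by (intro tree_connectivity_eq_0_iff) auto
  show "tree_connectivity k (digraph_complement D) = 0 \<longleftrightarrow> arc_strong_connectivity (digraph_complement D) = 0"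
    using assms by (intro tree_connectivity_eq_0_iff pair_digraph_complement) auto
qed

section \<open>Extremal digraphs\<close>

definition complete_digraph :: "nat \<Rightarrow> nat pair_pre_digraph" where
  "complete_digraph n = \<lparr> pverts = {..<n}, parcs = {(u, v). u < n \<and> v < n \<and> u \<noteq> v} \<rparr>"

definition circulant :: "nat \<Rightarrow> nat \<Rightarrow> nat pair_pre_digraph" where
  "circulant n m = \<lparr> pverts = {..<n},
     parcs = {(u, v). u < n \<and> v < n \<and> (int v - int u) mod int n \<in> {1..int m}} \<rparr>"

definition transitive_tournament :: "nat \<Rightarrow> nat pair_pre_digraph" where
  "transitive_tournament n = \<lparr> pverts = {..<n}, parcs = {(u, v). u < v \<and> v < n} \<rparr>"

lemma pair_digraph_nat:
  assumes "pverts D = {..<n::nat}" "\<And>u v. (u, v) \<in> parcs D \<Longrightarrow> u < n \<and> v < n \<and> u \<noteq> v"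
  shows "pair_digraph D"
proof
  show "finite (parcs D)"
    by (rule finite_subset[of _ "{..<n} \<times> {..<n}"]) (use assms in auto)
  show "finite (pverts D)" using assms by simp
  show "fst e \<in> pverts D" "snd e \<in> pverts D" "fst e \<noteq> snd e" if "e \<in> parcs D" for e
    using assms(1) assms(2)[of "fst e" "snd e"] that by auto
qed

text \<open>
  The tree with index \<open>j \<noteq> r\<close> consists of the arc from \<open>r\<close> to \<open>j\<close> and the arcs from \<open>j\<close> to all other
  vertices.
\<close>

lemma le_tree_connectivity_complete_digraph:
  assumes "2 \<le> k" "k \<le> n"
  shows "n - 1 \<le> tree_connectivity k (complete_digraph n)"
proof (rule le_tree_connectivityI)
  show D: "pair_digraph (complete_digraph n)"
    by (rule pair_digraph_nat[of _ n]) (auto simp: complete_digraph_def)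
  fix S r assume S: "S \<subseteq> pverts (complete_digraph n)" "card S = k" "r \<in> S"
  have r: "r < n" using S by (auto simp: complete_digraph_def)
  let ?P = "\<lambda>j v. if v = j then r else j"
  let ?h = "\<lambda>j v. if v = r then 0 else if v = j then 1 else 2 :: nat"
  have "card ({..<n} - {r}) \<le> tree_connectivity_at (complete_digraph n) S r"
    by (rule card_le_tree_connectivity_at_parents[OF D S(1,3), where P = ?P and h = ?h])
      (use assms S(2) r in \<open>auto simp: complete_digraph_def inj_on_def split: if_splits\<close>)
  then show "n - 1 \<le> tree_connectivity_at (complete_digraph n) S r" using r by simp
qed (use assms in \<open>auto simp: complete_digraph_def\<close>)

text \<open>
  The parents in \<open>m\<close> spanning out-trees with root \<open>0\<close> of the circulant digraph with steps
  \<open>1, \<dots>, m\<close>, where \<open>2m \<le> n \<le> 2m + 2\<close>.  The tree with index \<open>j \<in> {1..m}\<close> starts with the arc from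
  \<open>0\<close> to \<open>j\<close>; the vertex \<open>j\<close> reaches the next \<open>m\<close> vertices \<open>j + 1, \<dots>, j + m\<close>; the last of these,
  \<open>m + j\<close>, reaches the rest up to \<open>n - 1\<close>.  The remaining vertices \<open>1, \<dots>, j - 1\<close> are reached
  by wrapping around \<open>n\<close>: their parent \<open>n - m - 1 + j\<close> has the out-neighbours \<open>n - m + j, \<dots>, n + j - 1\<close>,
  which modulo \<open>n\<close> include \<open>1, \<dots>, j - 1\<close>.
\<close>

definition circulant_parent :: "nat \<Rightarrow> nat \<Rightarrow> nat \<Rightarrow> nat \<Rightarrow> nat" where
  "circulant_parent n m j v =
     (if v = j then 0 else if v < j then n - m - 1 + j else if v \<le> m + j then j else m + j)"

text \<open>
  The stages of the description of the trees: the wrapped vertices below \<open>j\<close> come last, because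
  their parent may itself be a child of \<open>m + j\<close>.
\<close>

definition circulant_rank :: "nat \<Rightarrow> nat \<Rightarrow> nat \<Rightarrow> nat" where
  "circulant_rank m j v =
     (if v = 0 then 0 else if v = j then 1 else if v < j then 4 else if v \<le> m + j then 2 else 3)"

lemma circulant_parent:
  assumes "2 * m \<le> n" "n \<le> 2 * m + 2" "j \<in> {1..m}" "0 < v" "v < n"
  shows "circulant_parent n m j v < n"
    and "circulant_rank m j (circulant_parent n m j v) < circulant_rank m j v"
    and "(int v - int (circulant_parent n m j v)) mod int n \<in> {1..int m}"
proof -
  let ?p = "circulant_parent n m j v"
  show p: "?p < n" using assms by (auto simp: circulant_parent_def)
  show "circulant_rank m j ?p < circulant_rank m j v"
    using assms by (auto simp: circulant_parent_def circulant_rank_def)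
  show "(int v - int ?p) mod int n \<in> {1..int m}"
  proof (cases "v < j")
    case True
    then have "int v - int ?p = int (v + m + 1 - j) - int n"
      using assms by (auto simp: circulant_parent_def)
    then have "(int v - int ?p) mod int n = int (v + m + 1 - j) mod int n" by simp
    also have "\<dots> = int (v + m + 1 - j)" using assms True by simp
    finally show ?thesis using assms True by simp
  next
    case False
    then have "?p < v" "v - ?p \<le> m" using assms by (auto simp: circulant_parent_def)
    then show ?thesis using assms by (simp add: of_nat_diff[symmetric] del: of_nat_diff)
  qed
qed

text \<open>
  Fix \<open>v\<close>.  The index \<open>j = v\<close> alone yields the parent \<open>0\<close>.  The indices \<open>j > v\<close> yield
  \<open>n - m - 1 + j\<close>, those with \<open>j < v \<le> m + j\<close> yield \<open>j\<close>, those with \<open>m + j < v\<close> yield \<open>m + j\<close>.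
  Parents of the first and second kind differ because \<open>2m \<le> n\<close>, those of the second and third
  because indices are at most \<open>m\<close>; the first kind requires \<open>v < m\<close> and the third \<open>v > m\<close>.
\<close>

lemma inj_on_circulant_parent:
  assumes "2 * m \<le> n" "n \<le> 2 * m + 2" "0 < v" "v < n"
  shows "inj_on (\<lambda>j. circulant_parent n m j v) {1..m}"
  unfolding inj_on_def circulant_parent_def using assms by auto

text \<open>
  The trees rooted at \<open>0\<close> are moved to an arbitrary root \<open>r\<close> by the map \<open>i \<mapsto> r + s i\<close> modulo \<open>n\<close>.  The
  sign \<open>s\<close> allows for a circulant (\<open>s = 1\<close>) and a reversed circulant (\<open>s = -1\<close>), which is what
  the complement of a circulant is.
\<close>

lemma le_tree_connectivity_circulant:
  fixes D :: "nat pair_pre_digraph" and s :: int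
  assumes D: "pair_digraph D" and V: "pverts D = {..<n}" and s: "s * s = 1"
    and arcs: "\<And>u v. u < n \<Longrightarrow> v < n \<Longrightarrow> (s * (int v - int u)) mod int n \<in> {1..int m} \<Longrightarrow> (u, v) \<in> parcs D"
    and m: "2 * m \<le> n" "n \<le> 2 * m + 2" and k: "2 \<le> k" "k \<le> n"
  shows "m \<le> tree_connectivity k D"
proof (rule le_tree_connectivityI[OF D])
  fix S r assume S: "S \<subseteq> pverts D" "card S = k" "r \<in> S"
  then have r: "r < n" using V by auto
  have n: "0 < int n" using k by simp
  \<comment> \<open>the relabelling and its inverse\<close>
  define \<phi> where "\<phi> i = nat ((int r + s * int i) mod int n)" for i :: nat
  define \<psi> where "\<psi> v = nat ((s * (int v - int r)) mod int n)" for v :: nat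
  have int_\<phi>: "int (\<phi> i) = (int r + s * int i) mod int n" for i
    using n by (simp add: \<phi>_def)
  have int_\<psi>: "int (\<psi> v) = (s * (int v - int r)) mod int n" for v
    using n by (simp add: \<psi>_def)
  have mod_left: "(s * (x mod int n - y)) mod int n = (s * (x - y)) mod int n" for x y
    by (metis mod_diff_left_eq mod_mult_right_eq)
  have mod_right: "(s * (x - y mod int n)) mod int n = (s * (x - y)) mod int n" for x y
    by (metis mod_diff_right_eq mod_mult_right_eq)
  have \<phi>_less: "\<phi> i < n" for i using int_\<phi>[of i] n by (metis of_nat_less_iff pos_mod_bound)
  have \<psi>_less: "\<psi> v < n" for v using int_\<psi>[of v] n by (metis of_nat_less_iff pos_mod_bound)
  have \<psi>\<phi>: "\<psi> (\<phi> i) = i" if "i < n" for i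
  proof -
    have "int (\<psi> (\<phi> i)) = (s * (int r + s * int i - int r)) mod int n"
      unfolding int_\<psi> int_\<phi> by (rule mod_left)
    also have "s * (int r + s * int i - int r) = (s * s) * int i" by (simp add: algebra_simps)
    finally show ?thesis using s that by simp
  qed
  have \<phi>\<psi>: "\<phi> (\<psi> v) = v" if "v < n" for v
  proof -
    have "int (\<phi> (\<psi> v)) = (int r + s * (s * (int v - int r))) mod int n"
      unfolding int_\<psi> int_\<phi> by (metis mod_add_right_eq mod_mult_right_eq)
    also have "int r + s * (s * (int v - int r)) = int r + (s * s) * (int v - int r)" by simp
    finally show ?thesis using s that by simp
  qed
  have \<psi>_pos: "0 < \<psi> v" if "v < n" "v \<noteq> r" for v
  proof (rule ccontr)
    assume "\<not> 0 < \<psi> v"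
    then have "v = \<phi> 0" using \<phi>\<psi>[OF that(1)] by simp
    then show False using that r by (simp add: \<phi>_def)
  qed
  let ?P = "\<lambda>j v. \<phi> (circulant_parent n m j (\<psi> v))"
  let ?h = "\<lambda>j v. circulant_rank m j (\<psi> v)"
  have "card {1..m} \<le> tree_connectivity_at D S r"
  proof (rule card_le_tree_connectivity_at_parents[OF D S(1,3), where P = ?P and h = ?h])
    fix j v assume j: "j \<in> {1..m}" and "v \<in> pverts D - {r}"
    then have v: "v < n" "v \<noteq> r" using V by auto
    note c = circulant_parent[OF m j \<psi>_pos[OF v] \<psi>_less]
    have "(s * (int v - int (?P j v))) mod int n
        = (s * ((int r + s * int (\<psi> v)) mod int n - int (?P j v))) mod int n"
      using \<phi>\<psi>[OF v(1)] int_\<phi>[of "\<psi> v"] by simp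
    also have "\<dots> = (s * ((int r + s * int (\<psi> v)) - (int r + s * int (circulant_parent n m j (\<psi> v))))) mod int n"
      unfolding int_\<phi> by (simp only: mod_left mod_right)
    also have "s * ((int r + s * int (\<psi> v)) - (int r + s * int (circulant_parent n m j (\<psi> v))))
        = (s * s) * (int (\<psi> v) - int (circulant_parent n m j (\<psi> v)))"
      by (simp add: algebra_simps)
    finally show "(?P j v, v) \<in> parcs D \<and> ?h j (?P j v) < ?h j v"
      using arcs[OF \<phi>_less v(1)] c \<psi>\<phi>[OF c(1)] s by simp
  next
    fix v assume "v \<in> pverts D - {r}"
    then have v: "v < n" "v \<noteq> r" using V by auto
    show "inj_on (\<lambda>j. ?P j v) {1..m}"
    proof (rule inj_onI)
      fix i j assume ij: "i \<in> {1..m}" "j \<in> {1..m}" "?P i v = ?P j v"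
      then have "circulant_parent n m i (\<psi> v) = circulant_parent n m j (\<psi> v)"
        using \<psi>\<phi> circulant_parent(1)[OF m _ \<psi>_pos[OF v] \<psi>_less] by metis
      then show "i = j"
        using inj_on_circulant_parent[OF m \<psi>_pos[OF v] \<psi>_less] ij by (auto dest: inj_onD)
    qed
  qed (use S k in simp)
  then show "m \<le> tree_connectivity_at D S r" by simp
qed (use k V in auto)

text \<open>
  A nonzero residue of \<open>v - u\<close> lies outside \<open>{1..m}\<close> exactly if that of \<open>u - v\<close> lies in \<open>{1..q}\<close>,
  as the two residues add up to \<open>n = m + q + 1\<close>.
\<close>

lemma circulant_complement_arcs:
  assumes "u < n" "v < n" "(- (int v - int u)) mod int n \<in> {1..int q}" "n = m + q + 1"
  shows "(u, v) \<in> parcs (digraph_complement (circulant n m))"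
proof -
  let ?x = "int v - int u"
  have "(- ?x) mod int n \<noteq> 0" using assms(3) by auto
  then have neg: "(- ?x) mod int n = int n - ?x mod int n"
    using zmod_zminus1_eq_if[of ?x "int n"] by (simp del: minus_diff_eq split: if_splits)
  then have "?x mod int n \<notin> {1..int m}" using assms by auto
  moreover have "u \<noteq> v" using assms(3) by auto
  ultimately show ?thesis using assms by (simp add: digraph_complement_def circulant_def)
qed

lemma floor_half_square:
  fixes m q :: nat
  assumes "q = m \<or> q = m + 1"
  shows "\<lfloor>(real (m + q) / 2) ^ 2\<rfloor> = int (m * q)"
  using assms
proof
  assume "q = m"
  then have "(real (m + q) / 2) ^ 2 = of_int (int (m * q))"
    by (simp add: power2_eq_square)
  then show ?thesis by (simp only: floor_of_int)
next
  assume "q = m + 1"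
  then have "(real (m + q) / 2) ^ 2 = of_int (int (m * q)) + 1 / 4"
    by (simp add: power2_eq_square field_simps)
  then show ?thesis by (intro floor_unique) simp_all
qed

lemma tree_connectivity_circulant_product:
  assumes q: "q = m \<or> q = m + 1" and n: "n = m + q + 1" and k: "2 \<le> k" "k \<le> n"
  defines "D \<equiv> circulant n m"
  shows "m * q \<le> tree_connectivity k D * tree_connectivity k (digraph_complement D)"
proof (rule mult_le_mono)
  have D: "pair_digraph D"
    by (rule pair_digraph_nat[of _ n]) (auto simp: circulant_def D_def)
  have V: "pverts D = {..<n}" by (simp add: D_def circulant_def)
  have mq: "2 * m \<le> n" "n \<le> 2 * m + 2" "2 * q \<le> n" "n \<le> 2 * q + 2"
    using q n by auto
  show "m \<le> tree_connectivity k D"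
  proof (rule le_tree_connectivity_circulant[OF D V _ _ mq(1,2) k, where s = 1])
    show "(u, v) \<in> parcs D"
      if "u < n" "v < n" "1 * (int v - int u) mod int n \<in> {1..int m}" for u v
      using that by (simp add: D_def circulant_def)
  qed simp
  show "q \<le> tree_connectivity k (digraph_complement D)"
  proof (rule le_tree_connectivity_circulant[OF pair_digraph_complement[OF D] _ _ _ mq(3,4) k, where s = "-1"])
    show "(u, v) \<in> parcs (digraph_complement D)"
      if "u < n" "v < n" "- 1 * (int v - int u) mod int n \<in> {1..int q}" for u v
      using circulant_complement_arcs[OF that(1,2) _ n] that(3) by (simp add: D_def)
  qed (use V in simp_all)
qed

text \<open>
  All walks go upwards in the tournament and downwards in its complement.
\<close>

lemma not_strongly_connected_transitive_tournament:
  assumes "2 \<le> n"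
  shows "\<not> strongly_connected (with_proj (transitive_tournament n))"
    and "\<not> strongly_connected (with_proj (digraph_complement (transitive_tournament n)))"
proof -
  let ?D = "transitive_tournament n"
  have up: "(x, y) \<in> (parcs ?D)\<^sup>* \<Longrightarrow> x \<le> y" for x y
    by (induction rule: rtrancl_induct) (auto simp: transitive_tournament_def)
  have down: "(x, y) \<in> (parcs (digraph_complement ?D))\<^sup>* \<Longrightarrow> y \<le> x" for x y
    by (induction rule: rtrancl_induct) (auto simp: transitive_tournament_def digraph_complement_def)
  have verts: "0 \<in> pverts ?D" "1 \<in> pverts ?D"
    using assms by (auto simp: transitive_tournament_def)
  show "\<not> strongly_connected (with_proj ?D)"
  proof
    assume "strongly_connected (with_proj ?D)"
    then have "reachable (with_proj ?D) 1 0"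
      using verts unfolding strongly_connected_def by simp
    then have "(1, 0) \<in> (parcs ?D)\<^sup>*"
      unfolding reachable_def with_proj_simps by (rule rtrancl_on_rtranclI)
    then show False using up[of 1 0] by simp
  qed
  show "\<not> strongly_connected (with_proj (digraph_complement ?D))"
  proof
    assume "strongly_connected (with_proj (digraph_complement ?D))"
    then have "reachable (with_proj (digraph_complement ?D)) 0 1"
      using verts unfolding strongly_connected_def by simp
    then have "(0, 1) \<in> (parcs (digraph_complement ?D))\<^sup>*"
      unfolding reachable_def with_proj_simps by (rule rtrancl_on_rtranclI)
    then show False using down[of 0 1] by simp
  qed
qed

theorem theorem6p7:
  fixes n k :: nat
  assumes "2 \<le> k" and "k \<le> n"
  shows
    "((\<forall>D :: 'a pair_pre_digraph. pair_digraph D \<and> card (pverts D) = n \<longrightarrow>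
        0 \<le> tree_connectivity k D + tree_connectivity k (digraph_complement D) \<and>
        tree_connectivity k D + tree_connectivity k (digraph_complement D) \<le> n - 1 \<and>
        (tree_connectivity k D + tree_connectivity k (digraph_complement D) = 0 \<longleftrightarrow>
           arc_strong_connectivity D = 0 \<and> arc_strong_connectivity (digraph_complement D) = 0))
     \<and> (\<exists>D :: nat pair_pre_digraph. pair_digraph D \<and> card (pverts D) = n \<and>
        tree_connectivity k D + tree_connectivity k (digraph_complement D) = 0)
     \<and> (\<exists>D :: nat pair_pre_digraph. pair_digraph D \<and> card (pverts D) = n \<and>
        tree_connectivity k D + tree_connectivity k (digraph_complement D) = n - 1))
     \<and>
     ((\<forall>D :: 'a pair_pre_digraph. pair_digraph D \<and> card (pverts D) = n \<longrightarrow>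
        0 \<le> tree_connectivity k D * tree_connectivity k (digraph_complement D) \<and>
        int (tree_connectivity k D * tree_connectivity k (digraph_complement D))
          \<le> \<lfloor>((real n - 1) / 2) ^ 2\<rfloor> \<and>
        (tree_connectivity k D * tree_connectivity k (digraph_complement D) = 0 \<longleftrightarrow>
           arc_strong_connectivity D = 0 \<or> arc_strong_connectivity (digraph_complement D) = 0))
     \<and> (\<exists>D :: nat pair_pre_digraph. pair_digraph D \<and> card (pverts D) = n \<and>
        tree_connectivity k D * tree_connectivity k (digraph_complement D) = 0)
     \<and> (\<exists>D :: nat pair_pre_digraph. pair_digraph D \<and> card (pverts D) = n \<and>
        int (tree_connectivity k D * tree_connectivity k (digraph_complement D))
          = \<lfloor>((real n - 1) / 2) ^ 2\<rfloor>))"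
proof -
  let ?\<kappa> = "tree_connectivity k"
  note all = tree_connectivity_complement_bounds[OF _ _ assms]
  have tournament: "\<exists>D :: nat pair_pre_digraph. pair_digraph D \<and> card (pverts D) = n \<and>
      ?\<kappa> D = 0 \<and> ?\<kappa> (digraph_complement D) = 0"
  proof (intro exI conjI)
    let ?D = "transitive_tournament n"
    show D: "pair_digraph ?D"
      by (rule pair_digraph_nat[of _ n]) (auto simp: transitive_tournament_def)
    show n: "card (pverts ?D) = n" by (simp add: transitive_tournament_def)
    show "?\<kappa> ?D = 0" "?\<kappa> (digraph_complement ?D) = 0"
      using not_strongly_connected_transitive_tournament[of n] assms n D pair_digraph_complement[OF D]
      by (auto simp: tree_connectivity_eq_0_iff arc_strong_connectivity_eq_0_iff)
  qed
  have complete: "\<exists>D :: nat pair_pre_digraph. pair_digraph D \<and> card (pverts D) = n \<and>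
      ?\<kappa> D + ?\<kappa> (digraph_complement D) = n - 1"
  proof (intro exI conjI)
    let ?D = "complete_digraph n"
    show D: "pair_digraph ?D"
      by (rule pair_digraph_nat[of _ n]) (auto simp: complete_digraph_def)
    show n: "card (pverts ?D) = n" by (simp add: complete_digraph_def)
    show "?\<kappa> ?D + ?\<kappa> (digraph_complement ?D) = n - 1"
      using all(1)[OF D n] le_tree_connectivity_complete_digraph[OF assms] by linarith
  qed
  have circulant: "\<exists>D :: nat pair_pre_digraph. pair_digraph D \<and> card (pverts D) = n \<and>
      int (?\<kappa> D * ?\<kappa> (digraph_complement D)) = \<lfloor>((real n - 1) / 2) ^ 2\<rfloor>"
  proof (intro exI conjI)
    define m where "m = (n - 1) div 2"
    define q where "q = n - 1 - m"
    have q: "q = m \<or> q = m + 1" and n_eq: "n = m + q + 1"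
      using assms unfolding q_def m_def by linarith+
    let ?D = "circulant n m"
    show D: "pair_digraph ?D"
      by (rule pair_digraph_nat[of _ n]) (auto simp: circulant_def)
    show n: "card (pverts ?D) = n" by (simp add: circulant_def)
    have "real n - 1 = real (m + q)" using n_eq by simp
    then have "\<lfloor>((real n - 1) / 2) ^ 2\<rfloor> = int (m * q)" using floor_half_square[OF q] by simp
    moreover have "int (m * q) \<le> int (?\<kappa> ?D * ?\<kappa> (digraph_complement ?D))"
      unfolding of_nat_le_iff by (rule tree_connectivity_circulant_product[OF q n_eq assms])
    ultimately show "int (?\<kappa> ?D * ?\<kappa> (digraph_complement ?D)) = \<lfloor>((real n - 1) / 2) ^ 2\<rfloor>"
      using all(2)[OF D n] by linarith
  qed
  show ?thesis
  proof (intro conjI allI impI)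
    show "\<exists>D :: nat pair_pre_digraph. pair_digraph D \<and> card (pverts D) = n \<and>
        ?\<kappa> D + ?\<kappa> (digraph_complement D) = n - 1" by (rule complete)
    show "\<exists>D :: nat pair_pre_digraph. pair_digraph D \<and> card (pverts D) = n \<and>
        int (?\<kappa> D * ?\<kappa> (digraph_complement D)) = \<lfloor>((real n - 1) / 2) ^ 2\<rfloor>" by (rule circulant)
    show "\<exists>D :: nat pair_pre_digraph. pair_digraph D \<and> card (pverts D) = n \<and>
        ?\<kappa> D + ?\<kappa> (digraph_complement D) = 0"
      and "\<exists>D :: nat pair_pre_digraph. pair_digraph D \<and> card (pverts D) = n \<and>
        ?\<kappa> D * ?\<kappa> (digraph_complement D) = 0"
      using tournament by auto
  next
    fix D :: "'a pair_pre_digraph"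
    assume "pair_digraph D \<and> card (pverts D) = n"
    then have D: "pair_digraph D" "card (pverts D) = n" by auto
    show "?\<kappa> D + ?\<kappa> (digraph_complement D) \<le> n - 1"
      and "int (?\<kappa> D * ?\<kappa> (digraph_complement D)) \<le> \<lfloor>((real n - 1) / 2) ^ 2\<rfloor>"
      by (rule all(1,2)[OF D])+
    show "?\<kappa> D + ?\<kappa> (digraph_complement D) = 0 \<longleftrightarrow>
        arc_strong_connectivity D = 0 \<and> arc_strong_connectivity (digraph_complement D) = 0"
      and "?\<kappa> D * ?\<kappa> (digraph_complement D) = 0 \<longleftrightarrow>
        arc_strong_connectivity D = 0 \<or> arc_strong_connectivity (digraph_complement D) = 0"
      using all(3,4)[OF D] by auto
  qed simp_all
qed

end
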